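(* Let $G$ be a connected graph of order $n\ge 2$ and let $\mathcal{H}=\{H_1,\ldots,H_n\}$ be a family of non-trivial graphs. For any $k\in\{1,\ldots,\min\{\mathcal{T}(G\circ\mathcal{H}),\mathcal{C}(\mathcal{H})\}\}$, $$\dim_k(G\circ\mathcal{H})\ge\sum_{i=1}^n\operatorname{adim}_k(H_i).$$
   Context: All graphs are finite and simple; non-trivial means at least two vertices; $V(G)=\{u_1,\ldots,u_n\}$. The lexicographic product $G\circ\mathcal{H}$ has vertex set $\bigcup_i\{u_i\}\times V(H_i)$, with $(u_i,v)\sim(u_j,w)$ iff $u_iu_j\in E(G)$, or $i=j$ and $vw\in E(H_i)$. For a connected graph $X$, $S\subseteq V(X)$ is a $k$-metric generator if every two distinct vertices $x,y$ admit at least $k$ vertices $w\in S$ with $d_X(x,w)\neq d_X(y,w)$; $\dim_k(X)$ is the minimum cardinality of a $k$-metric generator. For a graph $H$, $S\subseteq V(H)$ is a $k$-adjacency generator if every two distinct $x,y$ satisfy $|((N_H(x)\triangledown N_H(y))\cup\{x,y\})\cap S|\ge k$ ($\triangledown$ = symmetric difference); $\operatorname{adim}_k(H)$ is its minimum cardinality. $\mathcal{C}(H)=\min_{x\neq y}|(N_H(x)\triangledown N_H(y))\cup\{x,y\}|$, $\mathcal{C}(\mathcal{H})=\min_i\mathcal{C}(H_i)$. Twins in $G$: distinct $x,y$ are true twins if $N[x]=N[y]$, false twins if $N(x)=N(y)$; the relation $N(x)-\{y\}=N(y)-\{x\}$ partitions $V(G)$ into singleton classes, false twin classes and true twin classes,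 with unions $S(G)$, $FT(G)$, $TT(G)$ and class of $u_i$ denoted $FT(u_i)$ or $TT(u_i)$. $\mathcal{T}(u_i,\mathcal{H})=|V(H_i)|$ if $u_i\in S(G)$; $=\min\{\delta(H_j)+\delta(H_l)+2: u_j,u_l\in FT(u_i), j\neq l\}$ if $u_i\in FT(G)$; $=\min\{|V(H_j)|-\Delta(H_j)+|V(H_l)|-\Delta(H_l): u_j,u_l\in TT(u_i), j\neq l\}$ if $u_i\in TT(G)$; $\mathcal{T}(G\circ\mathcal{H})=\min_{u_i}\mathcal{T}(u_i,\mathcal{H})$. *)

theory Defs
  imports "Graph_Theory.Graph_Theory"
begin

text \<open>
  A finite simple graph is a \<^locale>\<open>pair_graph\<close>: a finite set of vertices with a symmetric,
  irreflexive adjacency relation \<^const>\<open>parcs\<close> on it, each edge being a pair of opposite arcs.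
\<close>

definition nbhd :: "'a pair_pre_digraph \<Rightarrow> 'a \<Rightarrow> 'a set" where
  "nbhd G x = {y \<in> pverts G. (x, y) \<in> parcs G}"

definition closed_nbhd :: "'a pair_pre_digraph \<Rightarrow> 'a \<Rightarrow> 'a set" where
  "closed_nbhd G x = insert x (nbhd G x)"

definition min_degree :: "'a pair_pre_digraph \<Rightarrow> nat" where
  "min_degree G = Min ((\<lambda>x. card (nbhd G x)) ` pverts G)"

definition max_degree :: "'a pair_pre_digraph \<Rightarrow> nat" where
  "max_degree G = Max ((\<lambda>x. card (nbhd G x)) ` pverts G)"

text \<open>A family of graphs is indexed by the vertices of the first factor.\<close>

definition lex_product ::
  "'a pair_pre_digraph \<Rightarrow> ('a \<Rightarrow> 'b pair_pre_digraph) \<Rightarrow> ('a \<times> 'b) pair_pre_digraph" where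
  "lex_product G H =
    \<lparr> pverts = (SIGMA u:pverts G. pverts (H u)),
      parcs = {((u, v), (u', w)) | u v u' w.
        u \<in> pverts G \<and> v \<in> pverts (H u) \<and> u' \<in> pverts G \<and> w \<in> pverts (H u') \<and>
        ((u, u') \<in> parcs G \<or> u = u' \<and> (v, w) \<in> parcs (H u))} \<rparr>"

text \<open>With unit weights the cost of a walk is its length.\<close>

definition gdist :: "'a pair_pre_digraph \<Rightarrow> 'a \<Rightarrow> 'a \<Rightarrow> ereal" where
  "gdist G x y = wf_digraph.\<mu> (with_proj G) (\<lambda>_. 1) x y"

definition k_metric_generator :: "nat \<Rightarrow> 'a pair_pre_digraph \<Rightarrow> 'a set \<Rightarrow> bool" where
  "k_metric_generator k G S \<longleftrightarrow> S \<subseteq> pverts G \<and>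
    (\<forall>x \<in> pverts G. \<forall>y \<in> pverts G. x \<noteq> y \<longrightarrow>
      k \<le> card {w \<in> S. gdist G x w \<noteq> gdist G y w})"

definition metric_dim :: "nat \<Rightarrow> 'a pair_pre_digraph \<Rightarrow> nat" where
  "metric_dim k G = Min (card ` {S. k_metric_generator k G S})"

definition adj_distinguishing :: "'a pair_pre_digraph \<Rightarrow> 'a \<Rightarrow> 'a \<Rightarrow> 'a set" where
  "adj_distinguishing G x y = (nbhd G x - nbhd G y) \<union> (nbhd G y - nbhd G x) \<union> {x, y}"

definition k_adjacency_generator :: "nat \<Rightarrow> 'a pair_pre_digraph \<Rightarrow> 'a set \<Rightarrow> bool" where
  "k_adjacency_generator k G S \<longleftrightarrow> S \<subseteq> pverts G \<and>
    (\<forall>x \<in> pverts G. \<forall>y \<in> pverts G. x \<noteq> y \<longrightarrow>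
      k \<le> card (adj_distinguishing G x y \<inter> S))"

definition adjacency_dim :: "nat \<Rightarrow> 'a pair_pre_digraph \<Rightarrow> nat" where
  "adjacency_dim k G = Min (card ` {S. k_adjacency_generator k G S})"

definition \<C> :: "'a pair_pre_digraph \<Rightarrow> nat" where
  "\<C> G = Min {card (adj_distinguishing G x y) | x y. x \<in> pverts G \<and> y \<in> pverts G \<and> x \<noteq> y}"

definition \<C>_family :: "'a pair_pre_digraph \<Rightarrow> ('a \<Rightarrow> 'b pair_pre_digraph) \<Rightarrow> nat" where
  "\<C>_family G H = Min ((\<lambda>u. \<C> (H u)) ` pverts G)"

definition true_twins :: "'a pair_pre_digraph \<Rightarrow> 'a \<Rightarrow> 'a \<Rightarrow> bool" where
  "true_twins G x y \<longleftrightarrow> x \<noteq> y \<and> closed_nbhd G x = closed_nbhd G y"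

definition false_twins :: "'a pair_pre_digraph \<Rightarrow> 'a \<Rightarrow> 'a \<Rightarrow> bool" where
  "false_twins G x y \<longleftrightarrow> x \<noteq> y \<and> nbhd G x = nbhd G y"

definition twin_rel :: "'a pair_pre_digraph \<Rightarrow> 'a rel" where
  "twin_rel G = {(x, y). x \<in> pverts G \<and> y \<in> pverts G \<and> nbhd G x - {y} = nbhd G y - {x}}"

definition singleton_classes :: "'a pair_pre_digraph \<Rightarrow> 'a set set" where
  "singleton_classes G = {C \<in> pverts G // twin_rel G. card C = 1}"

definition false_twin_classes :: "'a pair_pre_digraph \<Rightarrow> 'a set set" where
  "false_twin_classes G = {C \<in> pverts G // twin_rel G.
    2 \<le> card C \<and> (\<forall>x \<in> C. \<forall>y \<in> C. x \<noteq> y \<longrightarrow> false_twins G x y)}"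

definition true_twin_classes :: "'a pair_pre_digraph \<Rightarrow> 'a set set" where
  "true_twin_classes G = {C \<in> pverts G // twin_rel G.
    2 \<le> card C \<and> (\<forall>x \<in> C. \<forall>y \<in> C. x \<noteq> y \<longrightarrow> true_twins G x y)}"

text \<open>
  On the vertices of a graph the three cases below are exhaustive and mutually exclusive; the value
  0 is only taken outside the vertex set.
\<close>

definition \<T>_vertex :: "'a pair_pre_digraph \<Rightarrow> ('a \<Rightarrow> 'b pair_pre_digraph) \<Rightarrow> 'a \<Rightarrow> nat" where
  "\<T>_vertex G H u =
    (if u \<in> \<Union> (singleton_classes G) then card (pverts (H u))
     else if u \<in> \<Union> (false_twin_classes G) then
       Min {min_degree (H v) + min_degree (H w) + 2 | v w.
         v \<in> twin_rel G `` {u} \<and> w \<in> twin_rel G `` {u} \<and> v \<noteq> w}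
     else if u \<in> \<Union> (true_twin_classes G) then
       Min {(card (pverts (H v)) - max_degree (H v)) + (card (pverts (H w)) - max_degree (H w)) | v w.
         v \<in> twin_rel G `` {u} \<and> w \<in> twin_rel G `` {u} \<and> v \<noteq> w}
     else 0)"

definition \<T> :: "'a pair_pre_digraph \<Rightarrow> ('a \<Rightarrow> 'b pair_pre_digraph) \<Rightarrow> nat" where
  "\<T> G H = Min (\<T>_vertex G H ` pverts G)"

end

theory Submission
  imports Defs
begin

text \<open>
  Two vertices of one fibre \<open>{u} \<times> V(H u)\<close> have the same distance to every vertex outside that
  fibre, and distances inside the fibre only take the values 0, 1, 2 according to equality and
  adjacency in \<open>H u\<close>. Hence a \<open>k\<close>-metric generator of the product meets every fibre in a
  \<open>k\<close>-adjacency generator, and the inequality follows by adding up over the fibres.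

  The upper bound on \<open>k\<close> is only needed to guarantee that \<open>k\<close>-metric generators exist at all
  (otherwise \<^const>\<open>metric_dim\<close> is the minimum of an empty set): under that bound the whole vertex
  set is one.
\<close>

section \<open>Unit distances\<close>

context pair_wf_digraph
begin

lemma awalk_cost_unit: "awalk_cost (\<lambda>_. 1) p = real (length p)"
  by (induct p) auto

lemma gdist_le_length: "awalk x p y \<Longrightarrow> gdist G x y \<le> ereal (length p)"
  using min_cost_le_walk_cost[of x p y "\<lambda>_. 1"] by (simp add: gdist_def awalk_cost_unit)

text \<open>\<open>\<mu>\<close> is an infimum over walks, so unreachable vertices are covered too:
  the empty infimum is infinite.\<close>

lemma le_gdistI: "(\<And>p. awalk x p y \<Longrightarrow> c \<le> ereal (length p)) \<Longrightarrow> c \<le> gdist G x y"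
  unfolding gdist_def \<mu>_def by (rule INF_greatest) (simp add: awalk_cost_unit)

lemma gdist_nonneg: "0 \<le> gdist G x y"
  by (rule le_gdistI) simp

lemma one_le_gdist: "x \<noteq> y \<Longrightarrow> 1 \<le> gdist G x y"
proof (rule le_gdistI)
  fix p assume "x \<noteq> y" "awalk x p y"
  then show "1 \<le> ereal (length p)" by (cases p) (auto simp: awalk_Nil_iff one_ereal_def)
qed

text \<open>A walk joining distinct vertices has a first arc; were it the only one, it would be
  \<open>(x, y)\<close> itself.\<close>

lemma two_le_gdist:
  assumes "x \<noteq> y" "(x, y) \<notin> parcs G"
  shows "2 \<le> gdist G x y"
proof (rule le_gdistI)
  fix p assume p: "awalk x p y"
  with assms(1) obtain e q where e: "p = e # q" by (cases p) (auto simp: awalk_Nil_iff)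
  with p assms(2) obtain e' q' where "q = e' # q'"
    by (cases q) (auto simp: awalk_Nil_iff awalk_Cons_iff)
  with e have "(2::real) \<le> length p" by simp
  then show "2 \<le> ereal (length p)" by (metis ereal_less_eq(3) numeral_eq_ereal)
qed

lemma gdist_eq_0_iff: "x \<in> pverts G \<Longrightarrow> gdist G x y = 0 \<longleftrightarrow> x = y"
proof
  assume x: "x \<in> pverts G"
  { assume "x = y"
    \<comment> \<open>The empty walk is a walk only at a vertex of the graph; this is where
      \<open>x \<in> pverts G\<close> enters.\<close>
    with x have "gdist G x y \<le> ereal (length ([] :: ('a \<times> 'a) list))"
      by (intro gdist_le_length) (auto simp: awalk_Nil_iff)
    then show "gdist G x y = 0"
      using gdist_nonneg[of x y] by (simp add: zero_ereal_def[symmetric]) }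
  assume "gdist G x y = 0"
  then show "x = y" using one_le_gdist[of x y] by fastforce
qed

lemma gdist_eq_1_iff:
  assumes "x \<in> pverts G" "(x, x) \<notin> parcs G"
  shows "gdist G x y = 1 \<longleftrightarrow> (x, y) \<in> parcs G"
proof
  assume xy: "(x, y) \<in> parcs G"
  then have "awalk x [(x, y)] y" by (auto simp: awalk_simps dest: in_arcsD2)
  from gdist_le_length[OF this] have "gdist G x y \<le> 1" by (simp add: one_ereal_def)
  moreover from xy assms have "1 \<le> gdist G x y" by (intro one_le_gdist) auto
  ultimately show "gdist G x y = 1" by (rule antisym)
next
  assume d: "gdist G x y = 1"
  with assms(1) have "x \<noteq> y" using gdist_eq_0_iff[of x y] by auto
  with d show "(x, y) \<in> parcs G" using two_le_gdist[of x y] by fastforce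
qed

end

text \<open>The neighbour is the end of the first arc of a walk from \<open>u\<close> to any other
  vertex.\<close>

lemma (in pair_graph) ex_neighbour:
  assumes "connected (with_proj G)" "2 \<le> card (pverts G)" "u \<in> pverts G"
  obtains v where "(u, v) \<in> parcs G"
proof -
  have "\<not> pverts G \<subseteq> {u}" using assms(2) card_mono[of "{u}" "pverts G"] by fastforce
  then obtain w where w: "w \<in> pverts G" "w \<noteq> u" by auto
  have "strongly_connected (with_proj G)"
    using symmetric_connected_imp_strongly_connected pair_sym_arcs assms(1) by auto
  with assms(3) w(1) obtain p where "awalk u p w"
    by (auto simp: strongly_connected_def reachable_awalk)
  with w(2) that show thesis
    by (cases p) (auto simp: awalk_simps)
qed

section \<open>Twins\<close>

text \<open>Without loops, neither \<open>x\<close> nor \<open>y\<close> lies in either of the two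
  reduced neighbourhoods, so only third vertices matter.\<close>

lemma (in pair_graph) twin_rel_iff:
  "(x, y) \<in> twin_rel G \<longleftrightarrow> x \<in> pverts G \<and> y \<in> pverts G \<and>
    (\<forall>a. a \<noteq> x \<longrightarrow> a \<noteq> y \<longrightarrow> ((x, a) \<in> parcs G \<longleftrightarrow> (y, a) \<in> parcs G))"
proof -
  have "(a, a) \<notin> parcs G" for a using no_loops' by blast
  then show ?thesis
    unfolding twin_rel_def nbhd_def by (auto simp: set_eq_iff dest: in_arcsD2) (metis+)
qed

lemma (in pair_graph) twin_rel_trans:
  assumes xy: "(x, y) \<in> twin_rel G" and yz: "(y, z) \<in> twin_rel G"
  shows "(x, z) \<in> twin_rel G"
proof (cases "x = y \<or> y = z \<or> x = z")
  case True
  with xy yz show ?thesis by (auto simp: twin_rel_iff)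
next
  case False
  have "(x, a) \<in> parcs G \<longleftrightarrow> (z, a) \<in> parcs G" if a: "a \<noteq> x" "a \<noteq> z" for a
  proof (cases "a = y")
    \<comment> \<open>The middle vertex \<open>y\<close> is compared by neither hypothesis. The edge
      status of \<open>x\<close> and \<open>z\<close> serves as a detour: instantiate the twin
      condition of \<open>y\<close>, \<open>z\<close> at \<open>x\<close>, then that of
      \<open>x\<close>, \<open>y\<close> at \<open>z\<close>.\<close>
    case True
    have "(x, y) \<in> parcs G \<longleftrightarrow> (z, x) \<in> parcs G"
      using yz False arcs_symmetric by (fastforce simp: twin_rel_iff)
    also have "\<dots> \<longleftrightarrow> (z, y) \<in> parcs G"
      using xy False arcs_symmetric by (fastforce simp: twin_rel_iff)
    finally show ?thesis using True by simp
  next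
    case ay: False
    with xy yz a show ?thesis by (simp add: twin_rel_iff)
  qed
  with xy yz show ?thesis by (simp add: twin_rel_iff)
qed

lemma (in pair_graph) twin_rel_quotient_mem:
  assumes "C \<in> pverts G // twin_rel G" "x \<in> C" "(x, y) \<in> twin_rel G"
  shows "y \<in> C"
  using assms twin_rel_trans unfolding quotient_def by blast

section \<open>The invariant \<C> and its bound by the order of the graph\<close>

lemma card_adj_distinguishing_ge_\<C>:
  assumes "finite (pverts G)" "x \<in> pverts G" "y \<in> pverts G" "x \<noteq> y"
  shows "\<C> G \<le> card (adj_distinguishing G x y)"
proof -
  have "{card (adj_distinguishing G x y) | x y. x \<in> pverts G \<and> y \<in> pverts G \<and> x \<noteq> y}
    \<subseteq> (\<lambda>(x, y). card (adj_distinguishing G x y)) ` (pverts G \<times> pverts G)" by auto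
  from finite_subset[OF this] assms show ?thesis
    unfolding \<C>_def by (intro Min_le) auto
qed

lemma adj_distinguishing_subset:
  "x \<in> pverts G \<Longrightarrow> y \<in> pverts G \<Longrightarrow> adj_distinguishing G x y \<subseteq> pverts G"
  unfolding adj_distinguishing_def nbhd_def by auto

text \<open>For fibres over non-twins: there all vertices of one fibre separate, and
  \<open>k\<close> has to be at most their number.\<close>

lemma \<C>_le_card_verts:
  assumes "finite (pverts G)" "2 \<le> card (pverts G)"
  shows "\<C> G \<le> card (pverts G)"
proof -
  obtain x y where xy: "x \<in> pverts G" "y \<in> pverts G" "x \<noteq> y"
    using card_le_Suc0_iff_eq[OF assms(1)] assms(2) by auto
  from card_adj_distinguishing_ge_\<C>[OF assms(1) this]
    card_mono[OF assms(1) adj_distinguishing_subset[OF xy(1,2)]]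
  show ?thesis by simp
qed

section \<open>Lexicographic products\<close>

locale lex_family = pair_graph G
  for G :: "'a pair_pre_digraph" +
  fixes H :: "'a \<Rightarrow> 'b pair_pre_digraph"
  assumes conn: "connected (with_proj G)"
    and order: "2 \<le> card (pverts G)"
    and fibre_graph: "u \<in> pverts G \<Longrightarrow> pair_graph (H u)"
    and fibre_order: "u \<in> pverts G \<Longrightarrow> 2 \<le> card (pverts (H u))"
begin

abbreviation P where "P \<equiv> lex_product G H"

lemma finite_fibre: "u \<in> pverts G \<Longrightarrow> finite (pverts (H u))"
  using fibre_graph pair_graph_def pair_digraph_def pair_fin_digraph.pair_finite_verts by metis

lemma fibre_nonempty: "u \<in> pverts G \<Longrightarrow> pverts (H u) \<noteq> {}"
  using fibre_order[of u] by auto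

lemma pverts_P: "pverts P = (SIGMA u:pverts G. pverts (H u))"
  by (simp add: lex_product_def)

lemma parcs_P: "((u, v), (u', w)) \<in> parcs P \<longleftrightarrow>
    u \<in> pverts G \<and> v \<in> pverts (H u) \<and> u' \<in> pverts G \<and> w \<in> pverts (H u') \<and>
    ((u, u') \<in> parcs G \<or> u = u' \<and> (v, w) \<in> parcs (H u))"
  by (auto simp: lex_product_def)

lemma finite_P: "finite (pverts P)"
  unfolding pverts_P using pair_finite_verts finite_fibre by auto

lemma fibre_no_loop: "u \<in> pverts G \<Longrightarrow> (v, v) \<notin> parcs (H u)"
proof -
  assume "u \<in> pverts G"
  then interpret Hu: pair_graph "H u" by (rule fibre_graph)
  show "(v, v) \<notin> parcs (H u)" using Hu.no_loops' by blast
qed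

lemma no_loop_P: "(x, x) \<notin> parcs P"
  using no_loops' fibre_no_loop by (cases x) (auto simp: parcs_P)

lemma wf_P: "pair_wf_digraph P"
  by unfold_locales (auto simp: lex_product_def)

text \<open>Makes the facts on unit distances available for the product.\<close>

sublocale P: pair_wf_digraph P
  by (rule wf_P)

lemma gdist_P_eq_0_iff: "x \<in> pverts P \<Longrightarrow> gdist P x y = 0 \<longleftrightarrow> x = y"
  by (rule P.gdist_eq_0_iff)

lemma gdist_P_eq_1_iff: "x \<in> pverts P \<Longrightarrow> gdist P x y = 1 \<longleftrightarrow> (x, y) \<in> parcs P"
  by (rule P.gdist_eq_1_iff[OF _ no_loop_P])

section \<open>Distances in the product\<close>

text \<open>Cut off the part of the walk before it first leaves the fibre. The leaving arc comes
  from an edge of \<open>G\<close>, so it can start at any vertex of the fibre, in particular at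
  \<open>(u, v)\<close>.\<close>

lemma awalk_from_fibre:
  assumes "P.awalk x p z" "fst x = u" "fst z \<noteq> u" "v \<in> pverts (H u)"
  shows "\<exists>q. P.awalk (u, v) q z \<and> length q \<le> length p"
  using assms(1,2)
proof (induct p arbitrary: x)
  case Nil
  then show ?case using assms(3) by (auto simp: P.awalk_Nil_iff)
next
  case (Cons e p)
  obtain b where b: "(x, b) \<in> parcs P" "e = (x, b)" "P.awalk b p z"
    using Cons.prems(1) by (metis P.awalk_Cons_iff prod.collapse)
  show ?case
  proof (cases "fst b = u")
    case True
    from Cons.hyps[OF b(3) this] show ?thesis by (auto intro: le_SucI)
  next
    case False
    obtain x' b1 b2 where "x = (u, x')" "b = (b1, b2)"
      using Cons.prems(2) by (cases x, cases b) auto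
    with False b(1) assms(4) have "((u, v), b) \<in> parcs P"
      by (simp add: parcs_P)
    with b(3) have "P.awalk (u, v) (((u, v), b) # p) z" by (simp add: P.awalk_Cons_iff)
    then show ?thesis by (intro exI[of _ "((u, v), b) # p"]) simp
  qed
qed

lemma gdist_P_other_fibre:
  assumes "fst z \<noteq> u" "v \<in> pverts (H u)" "w \<in> pverts (H u)"
  shows "gdist P (u, v) z = gdist P (u, w) z"
proof -
  \<comment> \<open>One inequality for arbitrary \<open>v\<close> and \<open>w\<close>, used
    afterwards in both directions.\<close>
  have "gdist P (u, w) z \<le> gdist P (u, v) z" if "w \<in> pverts (H u)" for v w
  proof (rule P.le_gdistI)
    fix p assume "P.awalk (u, v) p z"
    from awalk_from_fibre[OF this _ assms(1) that]
    obtain q where q: "P.awalk (u, w) q z" "length q \<le> length p" by auto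
    then show "gdist P (u, w) z \<le> ereal (length p)"
      using P.gdist_le_length[OF q(1)] by (metis ereal_less_eq(3) of_nat_mono order_trans)
  qed
  with assms(2,3) show ?thesis by (blast intro: antisym)
qed

text \<open>Go to a vertex of the fibre over a neighbour \<open>u'\<close> of \<open>u\<close> and
  come back.\<close>

lemma gdist_P_le_2:
  assumes "u \<in> pverts G" "v \<in> pverts (H u)" "w \<in> pverts (H u)"
  shows "gdist P (u, v) (u, w) \<le> 2"
proof -
  obtain u' where u': "(u, u') \<in> parcs G" using ex_neighbour[OF conn order assms(1)] .
  then have "u' \<in> pverts G" "(u', u) \<in> parcs G" by (auto dest: in_arcsD2 arcs_symmetric)
  moreover from fibre_nonempty[OF this(1)] obtain v' where "v' \<in> pverts (H u')" by auto
  ultimately have "P.awalk (u, v) [((u, v), (u', v')), ((u', v'), (u, w))] (u, w)"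
    using u' assms by (auto simp: P.awalk_simps parcs_P pverts_P)
  from P.gdist_le_length[OF this] show ?thesis by (simp add: numeral_eq_ereal)
qed

lemma distinguishing_same_fibre:
  assumes u: "u \<in> pverts G" and v: "v \<in> pverts (H u)" and w: "w \<in> pverts (H u)" and "v \<noteq> w"
  shows "{z \<in> pverts P. gdist P (u, v) z \<noteq> gdist P (u, w) z}
    = Pair u ` adj_distinguishing (H u) v w"
proof (intro equalityI subsetI)
  fix z assume z: "z \<in> {z \<in> pverts P. gdist P (u, v) z \<noteq> gdist P (u, w) z}"
  then have "fst z = u" using gdist_P_other_fibre[OF _ v w] by blast
  with z obtain t where t: "z = (u, t)" "t \<in> pverts (H u)" by (cases z) (auto simp: pverts_P)
  \<comment> \<open>If \<open>t\<close> were outside the adjacency distinguishing set, it would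
    differ from \<open>v\<close> and \<open>w\<close> and be adjacent to both or to neither, so both
    distances would be 1 or both 2.\<close>
  have "gdist P (u, a) (u, t) = 2"
    if "a \<in> pverts (H u)" "a \<noteq> t" "(a, t) \<notin> parcs (H u)" for a
  proof (rule antisym)
    show "gdist P (u, a) (u, t) \<le> 2" using gdist_P_le_2[OF u that(1) t(2)] .
    show "2 \<le> gdist P (u, a) (u, t)"
      using that no_loops' by (intro P.two_le_gdist) (auto simp: parcs_P)
  qed
  moreover have "gdist P (u, a) (u, t) = 1" if "a \<in> pverts (H u)" "(a, t) \<in> parcs (H u)" for a
    using that u t(2) gdist_P_eq_1_iff[of "(u, a)" "(u, t)"] by (auto simp: parcs_P pverts_P)
  ultimately have "t \<in> adj_distinguishing (H u) v w"
    using z t v w by (force simp: adj_distinguishing_def nbhd_def)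
  with t show "z \<in> Pair u ` adj_distinguishing (H u) v w" by simp
next
  fix z assume "z \<in> Pair u ` adj_distinguishing (H u) v w"
  then obtain t where t: "z = (u, t)" "t \<in> adj_distinguishing (H u) v w" by auto
  have tV: "t \<in> pverts (H u)" using t(2) adj_distinguishing_subset[OF v w] by auto
  \<comment> \<open>For this inclusion the values 0 and 1 suffice: exactly one of the two distances
    takes one of them.\<close>
  have gdist_z: "gdist P (u, a) z = 0 \<longleftrightarrow> a = t" "gdist P (u, a) z = 1 \<longleftrightarrow> (a, t) \<in> parcs (H u)"
    if "a \<in> pverts (H u)" for a
    using that u tV t(1) no_loops' gdist_P_eq_0_iff[of "(u, a)" z] gdist_P_eq_1_iff[of "(u, a)" z]
    by (auto simp: parcs_P pverts_P)
  have "t = v \<or> t = w \<or> (v, t) \<in> parcs (H u) \<and> (w, t) \<notin> parcs (H u)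
      \<or> (w, t) \<in> parcs (H u) \<and> (v, t) \<notin> parcs (H u)"
    using t(2) by (auto simp: adj_distinguishing_def nbhd_def)
  then have "gdist P (u, v) z \<noteq> gdist P (u, w) z"
    using \<open>v \<noteq> w\<close> gdist_z[OF v] gdist_z[OF w] by auto
  with t(1) tV u show "z \<in> {z \<in> pverts P. gdist P (u, v) z \<noteq> gdist P (u, w) z}"
    by (auto simp: pverts_P)
qed

section \<open>Traces of a metric generator on the fibres\<close>

lemma k_adjacency_generator_fibre:
  assumes S: "k_metric_generator k P S" and u: "u \<in> pverts G"
  shows "k_adjacency_generator k (H u) (Pair u -` S)"
  unfolding k_adjacency_generator_def
proof (intro conjI ballI impI)
  have SP: "S \<subseteq> pverts P" using S by (simp add: k_metric_generator_def)
  then show "Pair u -` S \<subseteq> pverts (H u)" by (auto simp: pverts_P)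
  fix v w assume vw: "v \<in> pverts (H u)" "w \<in> pverts (H u)" "v \<noteq> w"
  have "{z \<in> S. gdist P (u, v) z \<noteq> gdist P (u, w) z}
    = {z \<in> pverts P. gdist P (u, v) z \<noteq> gdist P (u, w) z} \<inter> S" using SP by auto
  also have "\<dots> = Pair u ` (adj_distinguishing (H u) v w \<inter> Pair u -` S)"
    unfolding distinguishing_same_fibre[OF u vw] by auto
  finally have "card {z \<in> S. gdist P (u, v) z \<noteq> gdist P (u, w) z}
    = card (adj_distinguishing (H u) v w \<inter> Pair u -` S)"
    by (simp add: card_image inj_on_def)
  moreover have "k \<le> card {z \<in> S. gdist P (u, v) z \<noteq> gdist P (u, w) z}"
    using S u vw by (auto simp: k_metric_generator_def pverts_P)
  ultimately show "k \<le> card (adj_distinguishing (H u) v w \<inter> Pair u -` S)" by simp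
qed

lemma adjacency_dim_fibre_le:
  assumes "k_metric_generator k P S" "u \<in> pverts G"
  shows "adjacency_dim k (H u) \<le> card (Pair u -` S)"
proof -
  have "{S. k_adjacency_generator k (H u) S} \<subseteq> Pow (pverts (H u))"
    by (auto simp: k_adjacency_generator_def)
  from finite_subset[OF this] finite_fibre[OF assms(2)] k_adjacency_generator_fibre[OF assms]
  show ?thesis unfolding adjacency_dim_def by (intro Min_le) auto
qed

lemma sum_adjacency_dim_le:
  assumes S: "k_metric_generator k P S"
  shows "(\<Sum>u\<in>pverts G. adjacency_dim k (H u)) \<le> card S"
proof -
  have SP: "S \<subseteq> pverts P" using S by (simp add: k_metric_generator_def)
  have "(\<Sum>u\<in>pverts G. adjacency_dim k (H u)) \<le> (\<Sum>u\<in>pverts G. card (Pair u -` S))"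
    by (intro sum_mono adjacency_dim_fibre_le[OF S])
  also have "\<dots> = card (SIGMA u:pverts G. Pair u -` S)"
  proof (rule card_SigmaI[symmetric])
    show "finite (pverts G)" by (rule pair_finite_verts)
    show "\<forall>u\<in>pverts G. finite (Pair u -` S)"
      using finite_subset[OF SP finite_P] by (auto intro: finite_vimageI simp: inj_on_def)
  qed
  \<comment> \<open>The traces partition \<open>S\<close> because the fibres partition the
    product.\<close>
  also have "(SIGMA u:pverts G. Pair u -` S) = S" using SP by (auto simp: pverts_P)
  finally show ?thesis .
qed

section \<open>Existence of generators\<close>

text \<open>The whole fibre over a vertex \<open>a\<close> separating \<open>u\<close> from \<open>u'\<close> in \<open>G\<close> does the work.\<close>

lemma distinguishing_non_twins:
  assumes "u \<in> pverts G" "u' \<in> pverts G" "v \<in> pverts (H u)" "v' \<in> pverts (H u')"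
    and "(u, u') \<notin> twin_rel G" and k: "\<And>a. a \<in> pverts G \<Longrightarrow> k \<le> card (pverts (H a))"
  shows "k \<le> card {z \<in> pverts P. gdist P (u, v) z \<noteq> gdist P (u', v') z}"
proof -
  from assms(1,2,5) obtain a where a: "a \<in> pverts G" "a \<noteq> u" "a \<noteq> u'"
    "(u, a) \<in> parcs G \<longleftrightarrow> (u', a) \<notin> parcs G"
    by (auto simp: twin_rel_iff dest: in_arcsD2)
  \<comment> \<open>As \<open>a\<close> differs from \<open>u\<close> and \<open>u'\<close>,
    adjacency to \<open>(a, t)\<close> is decided in \<open>G\<close> alone, for every
    \<open>t\<close>.\<close>
  have "gdist P (u, v) (a, t) = 1 \<longleftrightarrow> gdist P (u', v') (a, t) \<noteq> 1" if "t \<in> pverts (H a)" for t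
    using that a assms gdist_P_eq_1_iff[of "(u, v)" "(a, t)"] gdist_P_eq_1_iff[of "(u', v')" "(a, t)"]
    by (auto simp: parcs_P pverts_P)
  then have "Pair a ` pverts (H a) \<subseteq> {z \<in> pverts P. gdist P (u, v) z \<noteq> gdist P (u', v') z}"
    using a(1) by (fastforce simp: pverts_P)
  from card_mono[OF _ this] finite_P have "card (pverts (H a))
    \<le> card {z \<in> pverts P. gdist P (u, v) z \<noteq> gdist P (u', v') z}"
    by (simp add: card_image inj_on_def)
  with k[OF a(1)] show ?thesis by simp
qed

section \<open>Separating vertices in fibres over twins\<close>

text \<open>The twin cases of \<open>\<T>_vertex\<close> are sums with one contribution from each of
  two fibres; disjointness lets the contributions add up.\<close>

lemma card_distinguishing_two_fibres:
  assumes "u \<noteq> u'" "A \<subseteq> pverts (H u)" "B \<subseteq> pverts (H u')" "u \<in> pverts G" "u' \<in> pverts G"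
    and "\<And>t. t \<in> A \<Longrightarrow> gdist P x (u, t) \<noteq> gdist P y (u, t)"
    and "\<And>t. t \<in> B \<Longrightarrow> gdist P x (u', t) \<noteq> gdist P y (u', t)"
  shows "card A + card B \<le> card {z \<in> pverts P. gdist P x z \<noteq> gdist P y z}"
proof -
  have "card A + card B = card (Pair u ` A) + card (Pair u' ` B)"
    by (simp add: card_image inj_on_def)
  also have "\<dots> = card (Pair u ` A \<union> Pair u' ` B)"
    using assms(1-5) by (intro card_Un_disjoint[symmetric])
      (auto intro: finite_subset[OF _ finite_fibre])
  also have "\<dots> \<le> card {z \<in> pverts P. gdist P x z \<noteq> gdist P y z}"
    using assms finite_P by (intro card_mono) (auto simp: pverts_P)
  finally show ?thesis .
qed

text \<open>From \<open>(u, v)\<close> the distance is at most 1, whereas \<open>(u', v')\<close> is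
  neither equal nor adjacent to \<open>(u, t)\<close>.\<close>

lemma false_twins_distinguish:
  assumes u: "u \<in> pverts G" and u': "u' \<in> pverts G" and "u \<noteq> u'" and nadj: "(u', u) \<notin> parcs G"
    and v: "v \<in> pverts (H u)" and v': "v' \<in> pverts (H u')"
    and t: "t \<in> closed_nbhd (H u) v"
  shows "gdist P (u, v) (u, t) \<noteq> gdist P (u', v') (u, t)"
proof -
  have tV: "t \<in> pverts (H u)" using t v by (auto simp: closed_nbhd_def nbhd_def)
  have "gdist P (u', v') (u, t) \<noteq> 0" "gdist P (u', v') (u, t) \<noteq> 1"
    using assms gdist_P_eq_0_iff[of "(u', v')" "(u, t)"] gdist_P_eq_1_iff[of "(u', v')" "(u, t)"]
    by (auto simp: parcs_P pverts_P)
  moreover have "gdist P (u, v) (u, t) = 0 \<or> gdist P (u, v) (u, t) = 1"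
    using t tV u v gdist_P_eq_0_iff[of "(u, v)" "(u, t)"] gdist_P_eq_1_iff[of "(u, v)" "(u, t)"]
    by (auto simp: parcs_P pverts_P closed_nbhd_def nbhd_def)
  ultimately show ?thesis by auto
qed

text \<open>Since \<open>u'\<close> and \<open>u\<close> are adjacent, \<open>(u', v')\<close> is at
  distance 1 from the whole fibre over \<open>u\<close>, so every non-neighbour of \<open>v\<close>,
  including \<open>v\<close>, separates.\<close>

lemma true_twins_distinguish:
  assumes u: "u \<in> pverts G" and u': "u' \<in> pverts G" and adj: "(u', u) \<in> parcs G"
    and v: "v \<in> pverts (H u)" and v': "v' \<in> pverts (H u')"
    and t: "t \<in> pverts (H u) - nbhd (H u) v"
  shows "gdist P (u, v) (u, t) \<noteq> gdist P (u', v') (u, t)"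
proof -
  have "gdist P (u', v') (u, t) = 1"
    using assms gdist_P_eq_1_iff[of "(u', v')" "(u, t)"] by (auto simp: parcs_P pverts_P)
  moreover have "gdist P (u, v) (u, t) \<noteq> 1"
    using t u v no_loops' gdist_P_eq_1_iff[of "(u, v)" "(u, t)"]
    by (auto simp: parcs_P pverts_P nbhd_def)
  ultimately show ?thesis by auto
qed

text \<open>The extra 1 counts \<open>v\<close> itself; two fibres together give the 2 in the false
  twin case of \<open>\<T>_vertex\<close>.\<close>

lemma card_closed_nbhd_ge:
  assumes u: "u \<in> pverts G" and v: "v \<in> pverts (H u)"
  shows "min_degree (H u) + 1 \<le> card (closed_nbhd (H u) v)"
proof -
  have "finite (nbhd (H u) v)" "v \<notin> nbhd (H u) v"
    using finite_fibre[OF u] fibre_no_loop[OF u] by (auto simp: nbhd_def)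
  moreover have "min_degree (H u) \<le> card (nbhd (H u) v)"
    unfolding min_degree_def using finite_fibre[OF u] v by (intro Min_le) auto
  ultimately show ?thesis by (simp add: closed_nbhd_def)
qed

lemma card_non_nbhd_ge:
  assumes u: "u \<in> pverts G" and v: "v \<in> pverts (H u)"
  shows "card (pverts (H u)) - max_degree (H u) \<le> card (pverts (H u) - nbhd (H u) v)"
proof -
  have "finite (nbhd (H u) v)" "nbhd (H u) v \<subseteq> pverts (H u)"
    using finite_fibre[OF u] by (auto simp: nbhd_def)
  moreover have "card (nbhd (H u) v) \<le> max_degree (H u)"
    unfolding max_degree_def using finite_fibre[OF u] v by (intro Max_ge) auto
  ultimately show ?thesis by (simp add: card_Diff_subset)
qed

text \<open>Stated for a general \<open>f\<close> to cover both minima in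
  \<open>\<T>_vertex\<close>.\<close>

lemma Min_twin_pairs_le:
  fixes f :: "'a \<Rightarrow> 'a \<Rightarrow> nat"
  assumes "(u, u') \<in> twin_rel G" "u \<noteq> u'"
  shows "Min {f v w | v w. v \<in> twin_rel G `` {u} \<and> w \<in> twin_rel G `` {u} \<and> v \<noteq> w} \<le> f u u'"
proof (rule Min_le)
  have "{f v w | v w. v \<in> twin_rel G `` {u} \<and> w \<in> twin_rel G `` {u} \<and> v \<noteq> w}
    \<subseteq> (\<lambda>(v, w). f v w) ` (pverts G \<times> pverts G)" by (auto simp: twin_rel_def)
  then show "finite {f v w | v w. v \<in> twin_rel G `` {u} \<and> w \<in> twin_rel G `` {u} \<and> v \<noteq> w}"
    by (rule finite_subset) (simp add: pair_finite_verts)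
  have "(u, u) \<in> twin_rel G" using assms(1) by (simp add: twin_rel_def)
  with assms show "f u u' \<in> {f v w | v w. v \<in> twin_rel G `` {u} \<and> w \<in> twin_rel G `` {u} \<and> v \<noteq> w}"
    by blast
qed

lemma distinguishing_twins:
  assumes uu': "(u, u') \<in> twin_rel G" "u \<noteq> u'" and v: "v \<in> pverts (H u)" "v' \<in> pverts (H u')"
    and k: "1 \<le> k" "k \<le> \<T>_vertex G H u"
  shows "k \<le> card {z \<in> pverts P. gdist P (u, v) z \<noteq> gdist P (u', v') z}" (is "_ \<le> card ?D")
proof -
  have u: "u \<in> pverts G" "u' \<in> pverts G" using uu' by (auto simp: twin_rel_def)
  \<comment> \<open>The class of \<open>u\<close> also contains its twin \<open>u'\<close>.\<close>
  have ns: "u \<notin> \<Union> (singleton_classes G)"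
  proof
    assume "u \<in> \<Union> (singleton_classes G)"
    then obtain C where C: "C \<in> pverts G // twin_rel G" "card C = 1" "u \<in> C"
      by (auto simp: singleton_classes_def)
    from twin_rel_quotient_mem[OF C(1,3) uu'(1)] C(2,3) uu'(2) show False
      by (auto simp: card_1_singleton_iff)
  qed
  show ?thesis
  proof (cases "u \<in> \<Union> (false_twin_classes G)")
    case True
    then obtain C where C: "C \<in> pverts G // twin_rel G" "u \<in> C"
      "\<forall>x \<in> C. \<forall>y \<in> C. x \<noteq> y \<longrightarrow> false_twins G x y"
      by (auto simp: false_twin_classes_def)
    have "false_twins G u u'" using twin_rel_quotient_mem[OF C(1,2) uu'(1)] C uu'(2) by auto
    then have "nbhd G u = nbhd G u'" by (simp add: false_twins_def)
    then have nadj: "(u, u') \<notin> parcs G" "(u', u) \<notin> parcs G"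
      using no_loops' u by (auto simp: nbhd_def)
    have "k \<le> min_degree (H u) + min_degree (H u') + 2"
      using k(2) ns True Min_twin_pairs_le[OF uu', of "\<lambda>v w. min_degree (H v) + min_degree (H w) + 2"]
      by (simp add: \<T>_vertex_def)
    also have "\<dots> \<le> card (closed_nbhd (H u) v) + card (closed_nbhd (H u') v')"
      using card_closed_nbhd_ge[OF u(1) v(1)] card_closed_nbhd_ge[OF u(2) v(2)] by linarith
    also have "\<dots> \<le> card ?D"
    proof (rule card_distinguishing_two_fibres[OF uu'(2) _ _ u])
      show "closed_nbhd (H u) v \<subseteq> pverts (H u)" "closed_nbhd (H u') v' \<subseteq> pverts (H u')"
        using v by (auto simp: closed_nbhd_def nbhd_def)
    \<comment> \<open>The second fibre is treated by exchanging the roles of the two vertices, which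
      reverses the inequation.\<close>
    qed (erule false_twins_distinguish[OF u uu'(2) nadj(2) v]
          false_twins_distinguish[OF u(2,1) uu'(2)[symmetric] nadj(1) v(2,1), symmetric])+
    finally show ?thesis .
  next
    case nf: False
    \<comment> \<open>The default value 0 of \<open>\<T>_vertex\<close> contradicts
      \<open>1 \<le> k\<close>, which leaves only the true twin case.\<close>
    with ns k have T: "u \<in> \<Union> (true_twin_classes G)" by (auto simp: \<T>_vertex_def split: if_splits)
    then obtain C where C: "C \<in> pverts G // twin_rel G" "u \<in> C"
      "\<forall>x \<in> C. \<forall>y \<in> C. x \<noteq> y \<longrightarrow> true_twins G x y"
      by (auto simp: true_twin_classes_def)
    have "true_twins G u u'" using twin_rel_quotient_mem[OF C(1,2) uu'(1)] C uu'(2) by auto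
    then have "closed_nbhd G u = closed_nbhd G u'" by (simp add: true_twins_def)
    then have adj: "(u, u') \<in> parcs G" "(u', u) \<in> parcs G"
      using uu'(2) by (auto simp: closed_nbhd_def nbhd_def)
    have "k \<le> (card (pverts (H u)) - max_degree (H u)) + (card (pverts (H u')) - max_degree (H u'))"
      using k(2) ns nf T Min_twin_pairs_le[OF uu', of "\<lambda>v w. (card (pverts (H v)) - max_degree (H v))
        + (card (pverts (H w)) - max_degree (H w))"]
      by (simp add: \<T>_vertex_def)
    also have "\<dots> \<le> card (pverts (H u) - nbhd (H u) v) + card (pverts (H u') - nbhd (H u') v')"
      using card_non_nbhd_ge u v by (intro add_mono) auto
    also have "\<dots> \<le> card ?D"
      by (rule card_distinguishing_two_fibres[OF uu'(2) Diff_subset Diff_subset u])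
        (erule true_twins_distinguish[OF u adj(2) v]
          true_twins_distinguish[OF u(2,1) adj(1) v(2,1), symmetric])+
    finally show ?thesis .
  qed
qed

text \<open>Pairs in one fibre are controlled by \<C>, pairs over distinct twins by \<T>, and pairs
  over non-twins again by \<C>, which bounds \<open>k\<close> by the order of each fibre.\<close>

lemma k_metric_generator_verts:
  assumes k: "1 \<le> k" "k \<le> \<T> G H" "k \<le> \<C>_family G H"
  shows "k_metric_generator k P (pverts P)"
  unfolding k_metric_generator_def
proof (intro conjI ballI impI)
  fix x y assume xy: "x \<in> pverts P" "y \<in> pverts P" "x \<noteq> y"
  obtain u v where x: "x = (u, v)" "u \<in> pverts G" "v \<in> pverts (H u)"
    using xy(1) by (auto simp: pverts_P)
  obtain u' v' where y: "y = (u', v')" "u' \<in> pverts G" "v' \<in> pverts (H u')"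
    using xy(2) by (auto simp: pverts_P)
  have kC: "k \<le> \<C> (H a)" if "a \<in> pverts G" for a
    using k(3) unfolding \<C>_family_def by (rule order_trans) (simp add: pair_finite_verts that)
  have kT: "k \<le> \<T>_vertex G H u"
    using k(2) unfolding \<T>_def by (rule order_trans) (simp add: pair_finite_verts x(2))
  consider (same) "u = u'" | (twins) "u \<noteq> u'" "(u, u') \<in> twin_rel G" | (other) "(u, u') \<notin> twin_rel G"
    by blast
  then show "k \<le> card {w \<in> pverts P. gdist P x w \<noteq> gdist P y w}"
  proof cases
    case same
    with x y xy(3) show ?thesis
      using kC[OF x(2)] card_adj_distinguishing_ge_\<C>[OF finite_fibre[OF x(2)], of v v']
      by (simp add: distinguishing_same_fibre card_image inj_on_def)
  next
    case twins
    with x y show ?thesis using distinguishing_twins[OF twins(2,1) x(3) y(3) k(1) kT] by simp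
  next
    case other
    have "k \<le> card (pverts (H a))" if "a \<in> pverts G" for a
      using kC[OF that] \<C>_le_card_verts[OF finite_fibre fibre_order] that by fastforce
    from distinguishing_non_twins[OF x(2) y(2) x(3) y(3) other this] show ?thesis
      using x y by simp
  qed
qed simp

end

theorem theorem11:
  fixes G :: "'a pair_pre_digraph"
    and H :: "'a \<Rightarrow> 'b pair_pre_digraph"
    and k :: nat
  assumes "pair_graph G"
    and "connected (with_proj G)"
    and "2 \<le> card (pverts G)"
    and "\<And>u. u \<in> pverts G \<Longrightarrow> pair_graph (H u)"
    and "\<And>u. u \<in> pverts G \<Longrightarrow> 2 \<le> card (pverts (H u))"
    and "k \<in> {1..min (\<T> G H) (\<C>_family G H)}"
  shows "metric_dim k (lex_product G H) \<ge> (\<Sum>u\<in>pverts G. adjacency_dim k (H u))"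
proof -
  interpret lex_family G H
    using assms(1-5) by (simp add: lex_family_def lex_family_axioms_def)
  have "k_metric_generator k P (pverts P)"
    using assms(6) by (intro k_metric_generator_verts) auto
  moreover have "{S. k_metric_generator k P S} \<subseteq> Pow (pverts P)"
    by (auto simp: k_metric_generator_def)
  then have "finite {S. k_metric_generator k P S}" using finite_P by (auto intro: finite_subset)
  \<comment> \<open>The minimum is attained, so \<open>metric_dim\<close> is the size of an actual
    generator, to which the sum over fibres applies.\<close>
  ultimately have "Min (card ` {S. k_metric_generator k P S}) \<in> card ` {S. k_metric_generator k P S}"
    by (intro Min_in) auto
  then obtain S where "k_metric_generator k P S" "metric_dim k P = card S"
    unfolding metric_dim_def by auto
  with sum_adjacency_dim_le show ?thesis by metis
qed

end
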